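(* Let $w:\mathbb{Z}\to(0,\infty)$ satisfy $\sum_{k\in\mathbb{Z}}w(k)=1$, let $\beta:\mathbb{Z}\to\mathbb{C}$ be a function for which both limits $\lim_{k\to\pm\infty}(\beta(k)-\beta(k-1))$ exist in $\mathbb{C}$, and let $\alpha:\mathbb{Z}\to\mathbb{C}$ satisfy $\sum_{k\in\mathbb{Z}}|\beta(k)-\alpha(k)|^2w(k)<\infty$. Let $D_{\beta,\tau_w}$ be the closure in $H_{\tau_w}$ of the operator with domain $\mathcal{A}$ given by $D_{\beta,\tau_w}a=\beta(\mathbb{K})a-a\alpha(\mathbb{K})$. Then $D_{\beta,\tau_w}$ has compact parametrices if and only if $\beta(k+n)-\alpha(k)\to\infty$ as $(n,k)\to\infty$ in $\mathbb{Z}^2$, i.e. for every $M>0$ one has $|\beta(k+n)-\alpha(k)|>M$ for all but finitely many pairs $(n,k)\in\mathbb{Z}^2$.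
   Context: Let $\{E_k\}_{k\in\mathbb{Z}}$ be the canonical basis of $\ell^2(\mathbb{Z})$, $UE_k=E_{k+1}$ the bilateral shift, and for $a:\mathbb{Z}\to\mathbb{C}$ let $a(\mathbb{K})$ be the diagonal operator $a(\mathbb{K})E_k=a(k)E_k$; then $a(\mathbb{K})U^n=U^na(\mathbb{K}+n)$. $H_{\tau_w}$ is the Hilbert space of formal series $f=\sum_{n\in\mathbb{Z}}U^nf_n(\mathbb{K})$, with $f_n:\mathbb{Z}\to\mathbb{C}$, such that $\|f\|^2=\sum_{n\in\mathbb{Z}}\sum_{k\in\mathbb{Z}}w(k)|f_n(k)|^2<\infty$. $\mathcal{A}\subset H_{\tau_w}$ is the set of finite sums $\sum_nU^na_n(\mathbb{K})$ with each $a_n$ eventually constant, meaning that for some $k_0$, $a_n$ is constant on $\{k\ge k_0\}$ and constant on $\{k\le-k_0\}$ (possibly different constants). In components, $\beta(\mathbb{K})a-a\alpha(\mathbb{K})=\sum_nU^n(\beta(\mathbb{K}+n)-\alpha(\mathbb{K}))a_n(\mathbb{K})$. A closed (densely defined) operator $D$ has compact parametrices if $(1+D^*D)^{-1/2}$ and $(1+DD^* )^{-1/2}$ are compact operators. *)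

theory Defs
  imports "HOL-Analysis.Analysis" "HOL-Library.Nonpos_Ints"
begin

definition wl2 :: "('i \<Rightarrow> real) \<Rightarrow> ('i \<Rightarrow> complex) set" where
  "wl2 \<mu> = {f. (\<lambda>i. \<mu> i * (cmod (f i))\<^sup>2) summable_on UNIV}"

definition wl2_inner :: "('i \<Rightarrow> real) \<Rightarrow> ('i \<Rightarrow> complex) \<Rightarrow> ('i \<Rightarrow> complex) \<Rightarrow> complex" where
  "wl2_inner \<mu> f g = (\<Sum>\<^sub>\<infinity>i. complex_of_real (\<mu> i) * (cnj (f i) * g i))"

definition wl2_norm :: "('i \<Rightarrow> real) \<Rightarrow> ('i \<Rightarrow> complex) \<Rightarrow> real" where
  "wl2_norm \<mu> f = sqrt (\<Sum>\<^sub>\<infinity>i. \<mu> i * (cmod (f i))\<^sup>2)"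

definition wl2_dist :: "('i \<Rightarrow> real) \<Rightarrow> ('i \<Rightarrow> complex) \<Rightarrow> ('i \<Rightarrow> complex) \<Rightarrow> real" where
  "wl2_dist \<mu> f g = wl2_norm \<mu> (\<lambda>i. f i - g i)"

definition wl2_topology :: "('i \<Rightarrow> real) \<Rightarrow> ('i \<Rightarrow> complex) topology" where
  "wl2_topology \<mu> = Metric_space.mtopology (wl2 \<mu>) (wl2_dist \<mu>)"

lemma wl2_triangle:
  assumes pos: "\<And>i. 0 < \<mu> i" and f: "f \<in> wl2 \<mu>" and g: "g \<in> wl2 \<mu>"
  shows "(\<lambda>i. f i + g i) \<in> wl2 \<mu>"
    and "wl2_norm \<mu> (\<lambda>i. f i + g i) \<le> wl2_norm \<mu> f + wl2_norm \<mu> g"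
proof -
  define B where "B = wl2_norm \<mu> f + wl2_norm \<mu> g"
  have L2: "L2_set (\<lambda>i. sqrt (\<mu> i) * cmod (h i)) F = sqrt (\<Sum>i\<in>F. \<mu> i * (cmod (h i))\<^sup>2)" for h F
    using pos by (simp add: L2_set_def power_mult_distrib less_imp_le)
  have le: "L2_set (\<lambda>i. sqrt (\<mu> i) * cmod (h i)) F \<le> wl2_norm \<mu> h"
    if "finite F" "h \<in> wl2 \<mu>" for h F
    unfolding L2 wl2_norm_def using that pos
    by (auto simp: wl2_def less_imp_le intro!: finite_sum_le_infsum)
  have bound: "(\<Sum>i\<in>F. \<mu> i * (cmod (f i + g i))\<^sup>2) \<le> B\<^sup>2" if F: "finite F" for F
  proof -
    have "L2_set (\<lambda>i. sqrt (\<mu> i) * cmod (f i + g i)) F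
        \<le> L2_set (\<lambda>i. sqrt (\<mu> i) * cmod (f i) + sqrt (\<mu> i) * cmod (g i)) F"
      using pos by (intro L2_set_mono)
        (auto simp: less_imp_le norm_triangle_ineq simp flip: distrib_left intro!: mult_left_mono)
    also have "\<dots> \<le> L2_set (\<lambda>i. sqrt (\<mu> i) * cmod (f i)) F + L2_set (\<lambda>i. sqrt (\<mu> i) * cmod (g i)) F"
      by (rule L2_set_triangle_ineq)
    also have "\<dots> \<le> B"
      unfolding B_def by (intro add_mono le F f g)
    finally show ?thesis
      unfolding L2 by (rule sqrt_le_D)
  qed
  show s: "(\<lambda>i. f i + g i) \<in> wl2 \<mu>"
    unfolding wl2_def using pos bound
    by (auto simp: less_imp_le intro!: nonneg_bdd_above_summable_on bdd_aboveI2)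
  have "(\<Sum>\<^sub>\<infinity>i. \<mu> i * (cmod (f i + g i))\<^sup>2) \<le> B\<^sup>2"
    using s bound by (auto simp: wl2_def intro!: infsum_le_finite_sums)
  moreover have "0 \<le> B"
    unfolding B_def wl2_norm_def using pos
    by (auto simp: less_imp_le intro!: infsum_nonneg add_nonneg_nonneg)
  ultimately show "wl2_norm \<mu> (\<lambda>i. f i + g i) \<le> wl2_norm \<mu> f + wl2_norm \<mu> g"
    by (auto simp: wl2_norm_def B_def intro!: real_le_lsqrt)
qed

lemma Metric_space_wl2:
  assumes pos: "\<And>i. 0 < \<mu> i"
  shows "Metric_space (wl2 \<mu>) (wl2_dist \<mu>)"
proof
  have neg: "(\<lambda>i. - f i) \<in> wl2 \<mu>" if "f \<in> wl2 \<mu>" for f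
    using that by (simp add: wl2_def)
  have diff: "(\<lambda>i. f i - g i) \<in> wl2 \<mu>" if "f \<in> wl2 \<mu>" "g \<in> wl2 \<mu>" for f g
    using wl2_triangle(1)[OF pos that(1) neg[OF that(2)]] by simp
  show "0 \<le> wl2_dist \<mu> f g" for f g
    using pos by (auto simp: wl2_dist_def wl2_norm_def less_imp_le intro!: infsum_nonneg)
  show "wl2_dist \<mu> f g = wl2_dist \<mu> g f" for f g
    by (simp add: wl2_dist_def wl2_norm_def norm_minus_commute)
  show "wl2_dist \<mu> f g = 0 \<longleftrightarrow> f = g" if fg: "f \<in> wl2 \<mu>" "g \<in> wl2 \<mu>" for f g
  proof
    assume "wl2_dist \<mu> f g = 0"
    then have "(\<Sum>\<^sub>\<infinity>i. \<mu> i * (cmod (f i - g i))\<^sup>2) = 0"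
      by (simp add: wl2_dist_def wl2_norm_def)
    then have "\<mu> i * (cmod (f i - g i))\<^sup>2 = 0" for i
      using diff[OF fg] pos nonneg_infsum_le_0D[of "\<lambda>i. \<mu> i * (cmod (f i - g i))\<^sup>2" UNIV i]
      by (auto simp: wl2_def less_imp_le)
    then show "f = g"
      using pos by (auto simp: fun_eq_iff less_le)
  qed (simp add: wl2_dist_def wl2_norm_def)
  show "wl2_dist \<mu> f h \<le> wl2_dist \<mu> f g + wl2_dist \<mu> g h"
    if "f \<in> wl2 \<mu>" "g \<in> wl2 \<mu>" "h \<in> wl2 \<mu>" for f g h
    using wl2_triangle(2)[OF pos diff[OF that(1,2)] diff[OF that(2,3)]]
    by (simp add: wl2_dist_def)
qed

text \<open>An operator is represented by its graph, a set of pairs (argument, value). Consequently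
  the product \<open>ST\<close> of operators is the relational composition \<open>T O S\<close>, and
  the inverse is the converse relation.\<close>

type_synonym 'i oper = "(('i \<Rightarrow> complex) \<times> ('i \<Rightarrow> complex)) set"

definition linear_oper :: "('i \<Rightarrow> real) \<Rightarrow> 'i oper \<Rightarrow> bool" where
  "linear_oper \<mu> T \<longleftrightarrow>
     T \<subseteq> wl2 \<mu> \<times> wl2 \<mu> \<and> single_valued T \<and> (\<lambda>i. 0, \<lambda>i. 0) \<in> T \<and>
     (\<forall>(f, g)\<in>T. \<forall>(f', g')\<in>T. (\<lambda>i. f i + f' i, \<lambda>i. g i + g' i) \<in> T) \<and>
     (\<forall>(f, g)\<in>T. \<forall>c. (\<lambda>i. c * f i, \<lambda>i. c * g i) \<in> T)"

definition oper_closure :: "('i \<Rightarrow> real) \<Rightarrow> 'i oper \<Rightarrow> 'i oper" where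
  "oper_closure \<mu> T = prod_topology (wl2_topology \<mu>) (wl2_topology \<mu>) closure_of T"

definition closed_densely_defined :: "('i \<Rightarrow> real) \<Rightarrow> 'i oper \<Rightarrow> bool" where
  "closed_densely_defined \<mu> T \<longleftrightarrow>
     linear_oper \<mu> T \<and>
     closedin (prod_topology (wl2_topology \<mu>) (wl2_topology \<mu>)) T \<and>
     wl2_topology \<mu> closure_of Domain T = wl2 \<mu>"

definition oper_adjoint :: "('i \<Rightarrow> real) \<Rightarrow> 'i oper \<Rightarrow> 'i oper" where
  "oper_adjoint \<mu> T =
     {(u, v). u \<in> wl2 \<mu> \<and> v \<in> wl2 \<mu> \<and> (\<forall>(f, g)\<in>T. wl2_inner \<mu> g u = wl2_inner \<mu> f v)}"

definition one_plus :: "'i oper \<Rightarrow> 'i oper" where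
  "one_plus T = {(f, \<lambda>i. f i + g i) | f g. (f, g) \<in> T}"

definition bounded_oper :: "('i \<Rightarrow> real) \<Rightarrow> 'i oper \<Rightarrow> bool" where
  "bounded_oper \<mu> T \<longleftrightarrow>
     linear_oper \<mu> T \<and> Domain T = wl2 \<mu> \<and>
     (\<exists>C. \<forall>(f, g)\<in>T. wl2_norm \<mu> g \<le> C * wl2_norm \<mu> f)"

definition positive_oper :: "('i \<Rightarrow> real) \<Rightarrow> 'i oper \<Rightarrow> bool" where
  "positive_oper \<mu> T \<longleftrightarrow> (\<forall>(f, g)\<in>T. wl2_inner \<mu> f g \<in> \<real>\<^sub>\<ge>\<^sub>0)"

text \<open>\<open>T\<^sup>-\<^sup>1\<^sup>/\<^sup>2\<close>, for \<open>T\<close> positive self-adjoint with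
  bounded inverse: the unique bounded positive square root of \<open>T\<^sup>-\<^sup>1\<close>.\<close>

definition inverse_sqrt :: "('i \<Rightarrow> real) \<Rightarrow> 'i oper \<Rightarrow> 'i oper" where
  "inverse_sqrt \<mu> T = (THE S. bounded_oper \<mu> S \<and> positive_oper \<mu> S \<and> S O S = T\<inverse>)"

definition compact_oper :: "('i \<Rightarrow> real) \<Rightarrow> 'i oper \<Rightarrow> bool" where
  "compact_oper \<mu> T \<longleftrightarrow>
     linear_oper \<mu> T \<and> Domain T = wl2 \<mu> \<and>
     compactin (wl2_topology \<mu>)
       (wl2_topology \<mu> closure_of (T `` {f \<in> wl2 \<mu>. wl2_norm \<mu> f \<le> 1}))"

definition has_compact_parametrices :: "('i \<Rightarrow> real) \<Rightarrow> 'i oper \<Rightarrow> bool" where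
  "has_compact_parametrices \<mu> D \<longleftrightarrow>
     closed_densely_defined \<mu> D \<and>
     compact_oper \<mu> (inverse_sqrt \<mu> (one_plus (D O oper_adjoint \<mu> D))) \<and>
     compact_oper \<mu> (inverse_sqrt \<mu> (one_plus (oper_adjoint \<mu> D O D)))"

text \<open>The formal series \<open>\<Sum>\<^sub>n U\<^sup>n f\<^sub>n(K)\<close> is represented by
  its coefficient family \<open>(n, k) \<mapsto> f\<^sub>n(k)\<close>. The Hilbert space \<open>H\<close> of such
  series is then \<open>wl2 (series_weight w)\<close>.\<close>

type_synonym series = "int \<times> int \<Rightarrow> complex"

definition series_weight :: "(int \<Rightarrow> real) \<Rightarrow> int \<times> int \<Rightarrow> real" where
  "series_weight w = (\<lambda>(n, k). w k)"

definition eventually_constant :: "(int \<Rightarrow> complex) \<Rightarrow> bool" where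
  "eventually_constant a \<longleftrightarrow>
     (\<exists>k0. (\<exists>c. \<forall>k\<ge>k0. a k = c) \<and> (\<exists>c. \<forall>k\<le>-k0. a k = c))"

definition series_algebra :: "series set" where
  "series_algebra =
     {a. finite {n. \<exists>k. a (n, k) \<noteq> 0} \<and> (\<forall>n. eventually_constant (\<lambda>k. a (n, k)))}"

text \<open>\<open>\<beta>(K) a\<close>; the shift of the argument comes from
  \<open>\<beta>(K) U\<^sup>n = U\<^sup>n \<beta>(K + n)\<close>.\<close>

definition diag_mult_left :: "(int \<Rightarrow> complex) \<Rightarrow> series \<Rightarrow> series" where
  "diag_mult_left \<beta> a = (\<lambda>(n, k). \<beta> (k + n) * a (n, k))"

definition diag_mult_right :: "series \<Rightarrow> (int \<Rightarrow> complex) \<Rightarrow> series" where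
  "diag_mult_right a \<alpha> = (\<lambda>(n, k). a (n, k) * \<alpha> k)"

definition D_oper :: "(int \<Rightarrow> real) \<Rightarrow> (int \<Rightarrow> complex) \<Rightarrow> (int \<Rightarrow> complex) \<Rightarrow> (int \<times> int) oper" where
  "D_oper w \<beta> \<alpha> = oper_closure (series_weight w)
     {(a, \<lambda>i. diag_mult_left \<beta> a i - diag_mult_right a \<alpha> i) | a. a \<in> series_algebra}"

end

theory Submission
  imports Defs
begin

text \<open>In the coordinates \<open>(n, k)\<close> the operator acts as multiplication by
  \<open>d (n, k) = \<beta> (k + n) - \<alpha> k\<close>, and the finitely supported families, which all lie in
  the algebra, form a core for the maximal multiplication operator by \<open>d\<close>. Hence
  \<open>D\<close> is that maximal operator, \<open>D\<^sup>*\<close> is multiplication by the conjugate of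
  \<open>d\<close>, and both \<open>(1 + D\<^sup>*D)\<^sup>-\<^sup>1\<^sup>/\<^sup>2\<close> and
  \<open>(1 + DD\<^sup>*)\<^sup>-\<^sup>1\<^sup>/\<^sup>2\<close> are multiplication by
  \<open>r = (1 + |d|\<^sup>2)\<^sup>-\<^sup>1\<^sup>/\<^sup>2\<close>. A multiplication operator is compact
  exactly when its symbol tends to \<open>0\<close>, that is, when \<open>|d|\<close> tends to infinity.\<close>

section \<open>Auxiliary facts on finite nets and infinite sums\<close>

text \<open>\<open>mtotally_bounded\<close> wants the centres inside \<open>S\<close>. Every
  external ball of radius \<open>e/2\<close> that meets \<open>S\<close> lies in a ball of radius
  \<open>e\<close> about one of the points where it meets \<open>S\<close>.\<close>

lemma (in Metric_space) mtotally_bounded_by_external_nets: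
  assumes "S \<subseteq> M"
    and net: "\<And>e. 0 < e \<Longrightarrow> \<exists>K. finite K \<and> K \<subseteq> M \<and> S \<subseteq> (\<Union>x\<in>K. mball x e)"
  shows "mtotally_bounded S"
  unfolding mtotally_bounded_def
proof (intro allI impI)
  fix e :: real
  assume "0 < e"
  then obtain K where K: "finite K" "K \<subseteq> M" "S \<subseteq> (\<Union>x\<in>K. mball x (e/2))"
    using net[of "e/2"] by auto
  define p where "p = (\<lambda>x. SOME y. y \<in> S \<inter> mball x (e/2))"
  define K' where "K' = p ` {x \<in> K. S \<inter> mball x (e/2) \<noteq> {}}"
  have p: "p x \<in> S \<inter> mball x (e/2)" if "S \<inter> mball x (e/2) \<noteq> {}" for x
    unfolding p_def by (rule someI_ex) (use that in blast)
  have "S \<subseteq> (\<Union>x\<in>K'. mball x e)"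
  proof
    fix y assume y: "y \<in> S"
    then obtain x where x: "x \<in> K" "y \<in> mball x (e/2)"
      using K by blast
    then have "S \<inter> mball x (e/2) \<noteq> {}"
      using y by blast
    then have "p x \<in> K'" "p x \<in> mball x (e/2)"
      using p[of x] x(1) by (auto simp: K'_def simp del: in_mball)
    moreover from this x have "y \<in> mball (p x) e"
      using triangle[of "p x" x y] commute[of x "p x"] by auto
    ultimately show "y \<in> (\<Union>x\<in>K'. mball x e)" by blast
  qed
  moreover have "finite K'" "K' \<subseteq> S"
    using K p by (auto simp: K'_def)
  ultimately show "\<exists>K. finite K \<and> K \<subseteq> S \<and> S \<subseteq> (\<Union>x\<in>K. mball x e)"
    by blast
qed

text \<open>In the divergent case both sums take the default value 0: taking real parts shows that
  the complex family is not summable either.\<close>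

lemma infsum_complex_of_real:
  "(\<Sum>\<^sub>\<infinity>i\<in>A. complex_of_real (h i)) = complex_of_real (\<Sum>\<^sub>\<infinity>i\<in>A. h i)"
proof (cases "h summable_on A")
  case True
  then show ?thesis
    by (intro infsumI has_sum_of_real has_sum_infsum)
next
  case False
  then have "\<not> (\<lambda>i. complex_of_real (h i)) summable_on A"
    using summable_on_Re[of "\<lambda>i. complex_of_real (h i)" A] by auto
  with False show ?thesis
    by (simp add: infsum_not_exists)
qed

lemma infsum_single_index:
  fixes h :: "'a \<Rightarrow> complex"
  assumes "\<And>j. j \<noteq> i \<Longrightarrow> h j = 0"
  shows "(\<Sum>\<^sub>\<infinity>j. h j) = h i"
proof -
  have "(\<Sum>\<^sub>\<infinity>j. h j) = infsum h {i}"
    by (rule infsum_cong_neutral) (use assms in auto)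
  then show ?thesis by simp
qed

subsection \<open>Weighted square-summable families\<close>

locale l2_weight =
  fixes \<mu> :: "'i \<Rightarrow> real"
  assumes pos: "0 < \<mu> i"
begin

sublocale Metric_space "wl2 \<mu>" "wl2_dist \<mu>"
  by (rule Metric_space_wl2) (rule pos)

lemma wl2_topology_eq: "wl2_topology \<mu> = mtopology"
  by (simp add: wl2_topology_def)

lemma weighted_nonneg: "0 \<le> \<mu> i * (cmod z)\<^sup>2"
  using pos[of i] by simp

lemma wl2_norm_nonneg: "0 \<le> wl2_norm \<mu> f"
  by (simp add: wl2_norm_def infsum_nonneg weighted_nonneg)

lemma wl2_norm_power2: "(wl2_norm \<mu> f)\<^sup>2 = (\<Sum>\<^sub>\<infinity>i. \<mu> i * (cmod (f i))\<^sup>2)"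
  by (simp add: wl2_norm_def infsum_nonneg weighted_nonneg)

lemma finite_sum_le_wl2_norm:
  assumes "f \<in> wl2 \<mu>" "finite F"
  shows "(\<Sum>i\<in>F. \<mu> i * (cmod (f i))\<^sup>2) \<le> (wl2_norm \<mu> f)\<^sup>2"
  unfolding wl2_norm_power2 using assms
  by (intro finite_sum_le_infsum) (auto simp: wl2_def weighted_nonneg)

text \<open>The terms are nonnegative, so a uniform bound on finite partial sums yields summability
  and bounds the infinite sum.\<close>

lemma wl2I_finite_sums:
  assumes "\<And>F. finite F \<Longrightarrow> (\<Sum>i\<in>F. \<mu> i * (cmod (f i))\<^sup>2) \<le> B\<^sup>2" and "0 \<le> B"
  shows "f \<in> wl2 \<mu>" and "wl2_norm \<mu> f \<le> B"
proof -
  show f: "f \<in> wl2 \<mu>"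
    unfolding wl2_def using assms(1)
    by (auto simp: weighted_nonneg intro!: nonneg_bdd_above_summable_on bdd_aboveI2)
  have "(wl2_norm \<mu> f)\<^sup>2 \<le> B\<^sup>2"
    unfolding wl2_norm_power2 using f assms(1)
    by (auto simp: wl2_def intro!: infsum_le_finite_sums)
  then show "wl2_norm \<mu> f \<le> B"
    using assms(2) by (rule power2_le_imp_le)
qed

lemma coordinate_le_wl2_norm:
  assumes "f \<in> wl2 \<mu>"
  shows "sqrt (\<mu> i) * cmod (f i) \<le> wl2_norm \<mu> f"
proof (rule power2_le_imp_le)
  show "(sqrt (\<mu> i) * cmod (f i))\<^sup>2 \<le> (wl2_norm \<mu> f)\<^sup>2"
    using finite_sum_le_wl2_norm[OF assms, of "{i}"] pos[of i] by (simp add: power_mult_distrib)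
qed (rule wl2_norm_nonneg)

lemma wl2_dominated:
  assumes f: "f \<in> wl2 \<mu>" and le: "\<And>i. cmod (g i) \<le> C * cmod (f i)" and C: "0 \<le> C"
  shows "g \<in> wl2 \<mu>" and "wl2_norm \<mu> g \<le> C * wl2_norm \<mu> f"
proof -
  have "(\<Sum>i\<in>F. \<mu> i * (cmod (g i))\<^sup>2) \<le> (C * wl2_norm \<mu> f)\<^sup>2" if F: "finite F" for F
  proof -
    have "(cmod (g i))\<^sup>2 \<le> C\<^sup>2 * (cmod (f i))\<^sup>2" for i
      using power_mono[OF le, of i 2] by (simp add: power_mult_distrib)
    then have "(\<Sum>i\<in>F. \<mu> i * (cmod (g i))\<^sup>2) \<le> (\<Sum>i\<in>F. \<mu> i * (C\<^sup>2 * (cmod (f i))\<^sup>2))"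
      using pos by (intro sum_mono mult_left_mono) (auto simp: less_imp_le)
    also have "\<dots> = C\<^sup>2 * (\<Sum>i\<in>F. \<mu> i * (cmod (f i))\<^sup>2)"
      by (simp add: sum_distrib_left mult_ac)
    also have "\<dots> \<le> C\<^sup>2 * (wl2_norm \<mu> f)\<^sup>2"
      by (intro mult_left_mono finite_sum_le_wl2_norm f F) simp
    finally show ?thesis
      by (simp add: power_mult_distrib)
  qed
  moreover have "0 \<le> C * wl2_norm \<mu> f"
    using C wl2_norm_nonneg by simp
  ultimately show "g \<in> wl2 \<mu>" and "wl2_norm \<mu> g \<le> C * wl2_norm \<mu> f"
    by (auto intro: wl2I_finite_sums)
qed

lemma wl2_zero: "(\<lambda>i. 0) \<in> wl2 \<mu>"
  by (simp add: wl2_def)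

lemma wl2_add: "f \<in> wl2 \<mu> \<Longrightarrow> g \<in> wl2 \<mu> \<Longrightarrow> (\<lambda>i. f i + g i) \<in> wl2 \<mu>"
  by (rule wl2_triangle(1)[OF pos])

lemma wl2_scale: "f \<in> wl2 \<mu> \<Longrightarrow> (\<lambda>i. c * f i) \<in> wl2 \<mu>"
  by (rule wl2_dominated(1)[where C = "cmod c" and f = f]) (auto simp: norm_mult)

lemma wl2_diff: "f \<in> wl2 \<mu> \<Longrightarrow> g \<in> wl2 \<mu> \<Longrightarrow> (\<lambda>i. f i - g i) \<in> wl2 \<mu>"
  using wl2_add[of f "\<lambda>i. - 1 * g i"] wl2_scale[of g "- 1"] by simp

lemma wl2_finite_support:
  assumes "finite {i. f i \<noteq> 0}"
  shows "f \<in> wl2 \<mu>"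
proof -
  have "(\<lambda>i. \<mu> i * (cmod (f i))\<^sup>2) summable_on {i. f i \<noteq> 0}"
    using assms by simp
  also have "?this \<longleftrightarrow> (\<lambda>i. \<mu> i * (cmod (f i))\<^sup>2) summable_on UNIV"
    by (rule summable_on_cong_neutral) auto
  finally show ?thesis
    by (simp add: wl2_def)
qed

text \<open>Turns coordinatewise approximation on a finite set into approximation in norm.\<close>

lemma wl2_norm_supported_le:
  assumes F: "finite F" and supp: "\<And>i. i \<notin> F \<Longrightarrow> f i = 0"
    and le: "\<And>i. i \<in> F \<Longrightarrow> sqrt (\<mu> i) * cmod (f i) \<le> e"
  shows "wl2_norm \<mu> f \<le> sqrt (card F) * e"
\<comment> \<open>The sign of \<open>e\<close> is read off from \<open>le\<close> at a point of
  \<open>F\<close>, so empty \<open>F\<close>, where both sides vanish, is treated apart.\<close>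
proof (cases "F = {}")
  case True
  then have "f = (\<lambda>i. 0)" using supp by auto
  then show ?thesis using True by (simp add: wl2_norm_def)
next
  case False
  then obtain i where "i \<in> F" by blast
  from le[OF this] have e: "0 \<le> e"
    using pos[of i] by (smt (verit) mult_nonneg_nonneg norm_ge_zero real_sqrt_ge_zero)
  have le2: "\<mu> i * (cmod (f i))\<^sup>2 \<le> e\<^sup>2" if "i \<in> F" for i
    using power_mono[OF le[OF that], of 2] pos[of i] by (simp add: power_mult_distrib less_imp_le)
  show ?thesis
  proof (rule wl2I_finite_sums(2))
    fix G :: "'i set" assume G: "finite G"
    have "(\<Sum>i\<in>G. \<mu> i * (cmod (f i))\<^sup>2) \<le> (\<Sum>i\<in>F. \<mu> i * (cmod (f i))\<^sup>2)"
    proof -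
      have "(\<Sum>i\<in>G. \<mu> i * (cmod (f i))\<^sup>2) = (\<Sum>i\<in>G \<inter> F. \<mu> i * (cmod (f i))\<^sup>2)"
        using G supp by (intro sum.mono_neutral_right) auto
      also have "\<dots> \<le> (\<Sum>i\<in>F. \<mu> i * (cmod (f i))\<^sup>2)"
        by (rule sum_mono2[OF F]) (auto simp: weighted_nonneg)
      finally show ?thesis .
    qed
    also have "\<dots> \<le> (\<Sum>i\<in>F. e\<^sup>2)"
      by (intro sum_mono le2)
    finally show "(\<Sum>i\<in>G. \<mu> i * (cmod (f i))\<^sup>2) \<le> (sqrt (card F) * e)\<^sup>2"
      by (simp add: power_mult_distrib)
  qed (use e in simp)
qed

text \<open>Truncation by zero, unlike \<open>restrict\<close>, whose value off \<open>F\<close> is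
  \<open>undefined\<close>.\<close>

definition restrict0 :: "'i set \<Rightarrow> ('i \<Rightarrow> complex) \<Rightarrow> 'i \<Rightarrow> complex" where
  "restrict0 F f = (\<lambda>i. if i \<in> F then f i else 0)"

lemma restrict0_wl2: "f \<in> wl2 \<mu> \<Longrightarrow> restrict0 F f \<in> wl2 \<mu>"
  by (rule wl2_dominated(1)[where C = 1 and f = f]) (auto simp: restrict0_def)

text \<open>The squared distance is the tail of a convergent sum. The filter form lets one
  \<open>F\<close> serve several vectors at once.\<close>

lemma eventually_restrict0_close:
  assumes f: "f \<in> wl2 \<mu>" and e: "0 < e"
  shows "\<forall>\<^sub>F F in finite_subsets_at_top UNIV. finite F \<and> wl2_dist \<mu> f (restrict0 F f) < e"
proof -
  let ?h = "\<lambda>i. \<mu> i * (cmod (f i))\<^sup>2"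
  have h: "?h summable_on UNIV"
    using f by (simp add: wl2_def)
  have "\<forall>\<^sub>F F in finite_subsets_at_top UNIV. dist (sum ?h F) (infsum ?h UNIV) < e\<^sup>2"
    using infsum_tendsto[OF h] e by (intro tendstoD) auto
  moreover have "\<forall>\<^sub>F F in finite_subsets_at_top UNIV. finite (F :: 'i set)"
    by (rule eventually_finite_subsets_at_top_weakI)
  ultimately show ?thesis
  proof eventually_elim
    case (elim F)
    have "(wl2_dist \<mu> f (restrict0 F f))\<^sup>2 = infsum ?h (UNIV - F)"
      unfolding wl2_dist_def wl2_norm_power2
      by (rule infsum_cong_neutral) (auto simp: restrict0_def)
    also have "\<dots> = infsum ?h UNIV - sum ?h F"
      using elim(2) by (subst infsum_Diff[OF h]) auto
    also have "\<dots> < e\<^sup>2"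
      using elim(1) by (simp add: dist_real_def)
    finally show ?case
      using e elim(2) by (simp add: power2_less_imp_less)
  qed
qed

text \<open>The usual completeness argument for l2: coordinates are dominated by the norm, so they
  converge, and bounds on finite partial sums survive the coordinatewise limit.\<close>

lemma mcomplete_wl2: "mcomplete"
  unfolding mcomplete_def
proof (intro allI impI)
  fix \<sigma> assume "MCauchy \<sigma>"
  then have \<sigma>: "\<And>n. \<sigma> n \<in> wl2 \<mu>" and C: "\<And>e. 0 < e \<Longrightarrow> \<exists>N. \<forall>n n'. N \<le> n \<longrightarrow> N \<le> n' \<longrightarrow> wl2_dist \<mu> (\<sigma> n) (\<sigma> n') < e"
    by (auto simp: MCauchy_def)
  have "Cauchy (\<lambda>n. \<sigma> n i)" for i
  proof (rule metric_CauchyI)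
    fix e :: real assume "0 < e"
    then have e: "0 < sqrt (\<mu> i) * e" using pos by simp
    from C[OF this] obtain N
      where N: "\<And>n n'. N \<le> n \<Longrightarrow> N \<le> n' \<Longrightarrow> wl2_dist \<mu> (\<sigma> n) (\<sigma> n') < sqrt (\<mu> i) * e"
      by blast
    have "dist (\<sigma> m i) (\<sigma> n i) < e" if "N \<le> m" "N \<le> n" for m n
    proof -
      have "sqrt (\<mu> i) * cmod (\<sigma> m i - \<sigma> n i) < sqrt (\<mu> i) * e"
        using coordinate_le_wl2_norm[OF wl2_diff[OF \<sigma> \<sigma>], of i m n] N[OF that]
        by (simp add: wl2_dist_def)
      then show ?thesis
        using pos[of i] by (simp add: dist_norm)
    qed
    then show "\<exists>M. \<forall>m\<ge>M. \<forall>n\<ge>M. dist (\<sigma> m i) (\<sigma> n i) < e"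
      by blast
  qed
  then have "\<exists>l. (\<lambda>n. \<sigma> n i) \<longlonglongrightarrow> l" for i
    by (simp add: Cauchy_convergent_iff convergent_def)
  then obtain f where f: "\<And>i. (\<lambda>n. \<sigma> n i) \<longlonglongrightarrow> f i"
    by metis
  have near: "\<exists>N. \<forall>n\<ge>N. (\<lambda>i. \<sigma> n i - f i) \<in> wl2 \<mu> \<and> wl2_norm \<mu> (\<lambda>i. \<sigma> n i - f i) \<le> e"
    if e: "0 < e" for e
  proof -
    obtain N where N: "\<And>n n'. N \<le> n \<Longrightarrow> N \<le> n' \<Longrightarrow> wl2_dist \<mu> (\<sigma> n) (\<sigma> n') < e"
      using C[OF e] by blast
    \<comment> \<open>With \<open>F\<close> and \<open>n\<close> fixed, let \<open>m\<close> tend to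
      infinity in the Cauchy estimate.\<close>
    have "(\<Sum>i\<in>F. \<mu> i * (cmod (\<sigma> n i - f i))\<^sup>2) \<le> e\<^sup>2" if "finite F" "N \<le> n" for F n
    proof (rule tendsto_upperbound)
      show "(\<lambda>m. \<Sum>i\<in>F. \<mu> i * (cmod (\<sigma> n i - \<sigma> m i))\<^sup>2) \<longlonglongrightarrow> (\<Sum>i\<in>F. \<mu> i * (cmod (\<sigma> n i - f i))\<^sup>2)"
        by (intro tendsto_intros f)
      show "\<forall>\<^sub>F m in sequentially. (\<Sum>i\<in>F. \<mu> i * (cmod (\<sigma> n i - \<sigma> m i))\<^sup>2) \<le> e\<^sup>2"
        using eventually_ge_at_top[of N]
      proof eventually_elim
        case (elim m)
        have "(wl2_norm \<mu> (\<lambda>i. \<sigma> n i - \<sigma> m i))\<^sup>2 \<le> e\<^sup>2"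
          using N[OF \<open>N \<le> n\<close> elim] wl2_norm_nonneg by (intro power_mono) (auto simp: wl2_dist_def)
        with finite_sum_le_wl2_norm[OF wl2_diff[OF \<sigma> \<sigma>] \<open>finite F\<close>, of n m] show ?case
          by simp
      qed
    qed simp
    then show ?thesis
      using wl2I_finite_sums e by (metis less_imp_le)
  qed
  obtain n where "(\<lambda>i. \<sigma> n i - f i) \<in> wl2 \<mu>"
    using near[of 1] by auto
  from wl2_diff[OF \<sigma>[of n] this] have fw: "f \<in> wl2 \<mu>"
    by simp
  have "limitin mtopology \<sigma> f sequentially"
    unfolding limitin_metric
  proof (intro conjI fw allI impI)
    fix e :: real assume "0 < e"
    then obtain N where "\<forall>n\<ge>N. wl2_norm \<mu> (\<lambda>i. \<sigma> n i - f i) \<le> e/2"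
      using near[of "e/2"] by auto
    then show "\<forall>\<^sub>F n in sequentially. \<sigma> n \<in> wl2 \<mu> \<and> wl2_dist \<mu> (\<sigma> n) f < e"
      using \<sigma> \<open>0 < e\<close> by (force simp: eventually_sequentially wl2_dist_def)
  qed
  then show "\<exists>x. limitin mtopology \<sigma> x sequentially" by blast
qed

text \<open>Evaluation at \<open>i\<close> is Lipschitz with constant
  \<open>1 / sqrt (\<mu> i)\<close>.\<close>

lemma continuous_map_coordinate: "continuous_map (wl2_topology \<mu>) euclidean (\<lambda>f. f i)"
  unfolding wl2_topology_eq mtopology_is_euclidean[symmetric]
proof (subst metric_continuous_map, (rule Met_TC.Metric_space_axioms)?, intro conjI ballI allI impI)
  fix f and e :: real assume f: "f \<in> wl2 \<mu>" and e: "0 < e"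
  have "dist (f i) (g i) < e" if "g \<in> wl2 \<mu>" "wl2_dist \<mu> f g < sqrt (\<mu> i) * e" for g
  proof -
    have "sqrt (\<mu> i) * cmod (f i - g i) < sqrt (\<mu> i) * e"
      using coordinate_le_wl2_norm[OF wl2_diff[OF f that(1)], of i] that(2)
      by (simp add: wl2_dist_def)
    then show ?thesis
      using pos[of i] by (simp add: dist_norm)
  qed
  moreover have "0 < sqrt (\<mu> i) * e"
    using pos e by simp
  ultimately show "\<exists>\<delta>>0. \<forall>g. g \<in> wl2 \<mu> \<and> wl2_dist \<mu> f g < \<delta> \<longrightarrow> dist (f i) (g i) < e"
    by blast
qed simp

end

subsection \<open>Multiplication operators\<close>

definition mult_oper :: "('i \<Rightarrow> real) \<Rightarrow> ('i \<Rightarrow> complex) \<Rightarrow> 'i oper" where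
  "mult_oper \<mu> d = {(f, \<lambda>i. d i * f i) | f. f \<in> wl2 \<mu> \<and> (\<lambda>i. d i * f i) \<in> wl2 \<mu>}"

lemma mem_mult_oper:
  "(f, g) \<in> mult_oper \<mu> d \<longleftrightarrow> f \<in> wl2 \<mu> \<and> g \<in> wl2 \<mu> \<and> g = (\<lambda>i. d i * f i)"
  by (auto simp: mult_oper_def)

context l2_weight
begin

section \<open>Closedness, core and density for maximal multiplication operators\<close>

lemma linear_mult_oper: "linear_oper \<mu> (mult_oper \<mu> d)"
  unfolding linear_oper_def
  by (auto simp: mem_mult_oper single_valued_def wl2_zero distrib_left mult.left_commute
      intro: wl2_add wl2_scale)

text \<open>The graph is cut out by one equation per index, each between continuous maps into a
  Hausdorff space.\<close>

lemma closedin_mult_oper: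
  "closedin (prod_topology (wl2_topology \<mu>) (wl2_topology \<mu>)) (mult_oper \<mu> d)"
proof -
  let ?X = "prod_topology (wl2_topology \<mu>) (wl2_topology \<mu>)"
  have "closedin ?X {p \<in> topspace ?X. snd p i = d i * fst p i}" for i
  proof (rule closedin_continuous_maps_eq)
    show "continuous_map ?X euclidean (\<lambda>p. snd p i)"
      using continuous_map_compose[OF continuous_map_snd continuous_map_coordinate]
      by (simp add: o_def)
    have "continuous_map ?X euclidean (\<lambda>p. fst p i)"
      using continuous_map_compose[OF continuous_map_fst continuous_map_coordinate]
      by (simp add: o_def)
    then have "continuous_map ?X euclidean ((\<lambda>z. d i * z) \<circ> (\<lambda>p. fst p i))"
      by (rule continuous_map_compose) (simp add: continuous_intros)
    then show "continuous_map ?X euclidean (\<lambda>p. d i * fst p i)"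
      by (simp add: o_def)
  qed (rule Hausdorff_space_euclidean)
  then have "closedin ?X (\<Inter>i. {p \<in> topspace ?X. snd p i = d i * fst p i})"
    by blast
  also have "(\<Inter>i. {p \<in> topspace ?X. snd p i = d i * fst p i}) = mult_oper \<mu> d"
    by (auto simp: mem_mult_oper wl2_topology_eq fun_eq_iff)
  finally show ?thesis .
qed

lemma finite_support_restrict0: "finite F \<Longrightarrow> finite {i. restrict0 F f i \<noteq> 0}"
  by (rule finite_subset[of _ F]) (auto simp: restrict0_def)

text \<open>The closure stays inside the closed graph of the maximal operator. Conversely,
  multiplication commutes with truncation, so truncating both components of a pair to the same
  finite set gives approximants in \<open>T\<close>.\<close>

lemma oper_closure_eq_mult_oper:
  assumes mult: "\<And>f g. (f, g) \<in> T \<Longrightarrow> g = (\<lambda>i. d i * f i)"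
    and fin: "\<And>f. finite {i. f i \<noteq> 0} \<Longrightarrow> (f, \<lambda>i. d i * f i) \<in> T"
  shows "oper_closure \<mu> T = mult_oper \<mu> d"
proof -
  let ?X = "prod_topology (wl2_topology \<mu>) (wl2_topology \<mu>)"
  \<comment> \<open>Pairs outside the product space do not affect the closure, so \<open>T\<close>
    is cut down to \<open>topspace\<close> before minimality of the closure is applied.\<close>
  have "?X closure_of T = ?X closure_of (topspace ?X \<inter> T)"
    by (rule closure_of_restrict)
  also have "\<dots> \<subseteq> mult_oper \<mu> d"
    by (rule closure_of_minimal[OF _ closedin_mult_oper])
      (auto simp: mem_mult_oper wl2_topology_eq dest: mult)
  finally have 1: "?X closure_of T \<subseteq> mult_oper \<mu> d" .
  have "(f, g) \<in> ?X closure_of T" if fg: "(f, g) \<in> mult_oper \<mu> d" for f g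
    unfolding in_closure_of
  proof (intro conjI allI impI)
    show "(f, g) \<in> topspace ?X"
      using fg by (auto simp: mem_mult_oper wl2_topology_eq)
    fix W assume "(f, g) \<in> W \<and> openin ?X W"
    then obtain U V where UV: "openin mtopology U" "openin mtopology V" "f \<in> U" "g \<in> V" "U \<times> V \<subseteq> W"
      by (metis openin_prod_topology_alt wl2_topology_eq)
    then obtain r s where rs: "0 < r" "mball f r \<subseteq> U" "0 < s" "mball g s \<subseteq> V"
      by (meson openin_mtopology)
    have f: "f \<in> wl2 \<mu>" and g: "g \<in> wl2 \<mu>"
      using fg by (auto simp: mem_mult_oper)
    obtain F where F: "finite F" "wl2_dist \<mu> f (restrict0 F f) < r"
        "wl2_dist \<mu> g (restrict0 F g) < s"
      using eventually_happens'[OF finite_subsets_at_top_neq_bot eventually_conj[OF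
          eventually_restrict0_close[OF f rs(1)] eventually_restrict0_close[OF g rs(3)]]]
      by blast
    have "restrict0 F f \<in> mball f r" "restrict0 F g \<in> mball g s"
      using F f g by (auto intro: restrict0_wl2)
    moreover have "restrict0 F g = (\<lambda>i. d i * restrict0 F f i)"
      using fg by (auto simp: mem_mult_oper restrict0_def)
    then have "(restrict0 F f, restrict0 F g) \<in> T"
      using fin[OF finite_support_restrict0[OF F(1)]] by simp
    ultimately show "\<exists>y. y \<in> T \<and> y \<in> W"
      using UV(5) rs by blast
  qed
  with 1 show ?thesis
    unfolding oper_closure_def by (auto simp: subset_eq)
qed

lemma closed_densely_defined_mult_oper: "closed_densely_defined \<mu> (mult_oper \<mu> d)"
  unfolding closed_densely_defined_def
proof (intro conjI linear_mult_oper closedin_mult_oper)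
  have "f \<in> mtopology closure_of Domain (mult_oper \<mu> d)" if f: "f \<in> wl2 \<mu>" for f
    unfolding metric_closure_of
  proof (intro CollectI conjI f allI impI)
    fix e :: real assume "0 < e"
    then obtain F where F: "finite F" "wl2_dist \<mu> f (restrict0 F f) < e"
      using eventually_happens'[OF finite_subsets_at_top_neq_bot eventually_restrict0_close[OF f]]
      by blast
    have "(\<lambda>i. d i * restrict0 F f i) \<in> wl2 \<mu>"
      by (rule wl2_finite_support, rule finite_subset[of _ F]) (auto simp: F restrict0_def)
    then have "restrict0 F f \<in> Domain (mult_oper \<mu> d)"
      using restrict0_wl2[OF f, of F] by (auto simp: mult_oper_def)
    then show "\<exists>y\<in>Domain (mult_oper \<mu> d). y \<in> mball f e"
      using F f restrict0_wl2[OF f, of F] by auto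
  qed
  moreover have "mtopology closure_of Domain (mult_oper \<mu> d) \<subseteq> wl2 \<mu>"
    using closure_of_subset_topspace[of mtopology] by simp
  ultimately show "wl2_topology \<mu> closure_of Domain (mult_oper \<mu> d) = wl2 \<mu>"
    unfolding wl2_topology_eq by blast
qed

section \<open>Basis vectors, adjoints and the inverse of one plus a square\<close>

definition unit_series :: "'i \<Rightarrow> 'i \<Rightarrow> complex" where
  "unit_series i = (\<lambda>j. if j = i then 1 else 0)"

lemma wl2_unit_scaled: "(\<lambda>j. d j * unit_series i j) \<in> wl2 \<mu>"
  by (rule wl2_finite_support, rule finite_subset[of _ "{i}"]) (auto simp: unit_series_def)

lemma wl2_unit: "unit_series i \<in> wl2 \<mu>"
  using wl2_unit_scaled[of "\<lambda>_. 1"] by simp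

text \<open>The factor is the constant \<open>d i\<close> rather than \<open>d j\<close>, which
  displays the basis vector as an eigenvector.\<close>

lemma unit_mem_mult_oper: "(unit_series i, \<lambda>j. d i * unit_series i j) \<in> mult_oper \<mu> d"
proof -
  have "(\<lambda>j. d i * unit_series i j) = (\<lambda>j. d j * unit_series i j)"
    by (auto simp: unit_series_def)
  then show ?thesis
    by (simp add: mem_mult_oper wl2_unit wl2_unit_scaled)
qed

text \<open>Testing the adjoint relation on basis vectors determines \<open>v\<close> coordinate by
  coordinate. In the other direction the two inner products agree term by term.\<close>

lemma oper_adjoint_mult_oper: "oper_adjoint \<mu> (mult_oper \<mu> d) = mult_oper \<mu> (\<lambda>i. cnj (d i))"
proof (intro equalityI subsetI)
  fix p assume "p \<in> oper_adjoint \<mu> (mult_oper \<mu> d)"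
  then obtain u v where p: "p = (u, v)" "u \<in> wl2 \<mu>" "v \<in> wl2 \<mu>"
    and eq: "\<And>f g. (f, g) \<in> mult_oper \<mu> d \<Longrightarrow> wl2_inner \<mu> g u = wl2_inner \<mu> f v"
    unfolding oper_adjoint_def by blast
  have "v i = cnj (d i) * u i" for i
  proof -
    have "wl2_inner \<mu> (\<lambda>j. d i * unit_series i j) u = wl2_inner \<mu> (unit_series i) v"
      by (rule eq[OF unit_mem_mult_oper])
    then have "complex_of_real (\<mu> i) * (cnj (d i) * u i) = complex_of_real (\<mu> i) * v i"
      unfolding wl2_inner_def
      by (subst (asm) (1 2) infsum_single_index[of i]) (auto simp: unit_series_def)
    then show ?thesis
      using pos[of i] by simp
  qed
  then show "p \<in> mult_oper \<mu> (\<lambda>i. cnj (d i))"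
    using p by (auto simp: mem_mult_oper)
next
  fix p assume "p \<in> mult_oper \<mu> (\<lambda>i. cnj (d i))"
  then show "p \<in> oper_adjoint \<mu> (mult_oper \<mu> d)"
    by (auto simp: mult_oper_def oper_adjoint_def wl2_inner_def mult_ac)
qed

text \<open>The point is the domains: for every \<open>f\<close>, the quotient
  \<open>g = f / (1 + |a|^2)\<close> must remain in the space after multiplication by
  \<open>cnj a\<close> and then by \<open>a\<close>. This holds since 1, \<open>|a|\<close> and
  \<open>|a|^2\<close> are all at most \<open>1 + |a|^2\<close>.\<close>

lemma inverse_one_plus_square_mult_oper:
  "(one_plus (mult_oper \<mu> (\<lambda>i. cnj (a i)) O mult_oper \<mu> a))\<inverse>
    = mult_oper \<mu> (\<lambda>i. complex_of_real (1 / (1 + (cmod (a i))\<^sup>2)))" (is "?L = ?R")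
proof -
  have nz: "1 + complex_of_real ((cmod (a i))\<^sup>2) \<noteq> 0" for i
    using of_real_eq_0_iff[where 'a = complex, of "1 + (cmod (a i))\<^sup>2"]
    by (smt (verit) of_real_1 of_real_add zero_le_power2)
  have sq: "a i * (cnj (a i) * z) = complex_of_real ((cmod (a i))\<^sup>2) * z" for i z
    by (simp only: complex_norm_square mult.assoc)
  show ?thesis
  proof (intro equalityI subsetI)
    fix p assume "p \<in> ?L"
    then obtain f g where p: "p = (\<lambda>i. f i + g i, f)" and f: "f \<in> wl2 \<mu>" "g \<in> wl2 \<mu>"
      and g: "g = (\<lambda>i. a i * (cnj (a i) * f i))"
      by (auto simp: one_plus_def mem_mult_oper)
    have "f i = complex_of_real (1 / (1 + (cmod (a i))\<^sup>2)) * (f i + g i)" for i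
      using nz[of i] unfolding g sq by (simp add: field_simps)
    then show "p \<in> ?R"
      using f wl2_add[OF f] unfolding p mem_mult_oper by blast
  next
    fix p assume "p \<in> ?R"
    then obtain f where p: "p = (f, \<lambda>i. complex_of_real (1 / (1 + (cmod (a i))\<^sup>2)) * f i)"
      and f: "f \<in> wl2 \<mu>"
      by (auto simp: mult_oper_def)
    define g where "g = (\<lambda>i. complex_of_real (1 / (1 + (cmod (a i))\<^sup>2)) * f i)"
    have den: "0 < 1 + (cmod (a i))\<^sup>2" for i
      by (smt (verit) zero_le_power2)
    have bound: "(\<lambda>i. c i * g i) \<in> wl2 \<mu>" if "\<And>i. cmod (c i) \<le> 1 + (cmod (a i))\<^sup>2" for c
    proof (rule wl2_dominated(1)[OF f, where C = 1])
      fix i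
      have "cmod (c i * g i) = cmod (c i) / (1 + (cmod (a i))\<^sup>2) * cmod (f i)"
        using den[of i] by (simp add: g_def norm_mult norm_divide del: of_real_add of_real_divide)
      also have "\<dots> \<le> 1 * cmod (f i)"
        using that[of i] den[of i] by (intro mult_right_mono) auto
      finally show "cmod (c i * g i) \<le> 1 * cmod (f i)" .
    qed simp
    \<comment> \<open>This is \<open>(|a i| - 1)^2 \<ge> 0\<close>.\<close>
    have "2 * cmod (a i) \<le> 1 + (cmod (a i))\<^sup>2" for i
      using zero_le_power2[of "cmod (a i) - 1"] by (simp add: power2_diff)
    then have "cmod (a i) \<le> 1 + (cmod (a i))\<^sup>2" for i
      by (smt (verit) norm_ge_zero)
    then have 1: "(\<lambda>i. cnj (a i) * g i) \<in> wl2 \<mu>"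
      by (intro bound) simp
    have 2: "(\<lambda>i. a i * (cnj (a i) * g i)) \<in> wl2 \<mu>"
      unfolding sq by (rule bound) (simp add: norm_power)
    have 3: "g \<in> wl2 \<mu>"
      using bound[of "\<lambda>_. 1"] by simp
    have 4: "f i = g i + a i * (cnj (a i) * g i)" for i
    proof -
      have "(1 + complex_of_real ((cmod (a i))\<^sup>2)) * g i = f i"
        using nz[of i] by (simp add: g_def)
      then show ?thesis
        unfolding sq by (simp only: distrib_right mult_1_left)
    qed
    have "(g, \<lambda>i. a i * (cnj (a i) * g i)) \<in> mult_oper \<mu> (\<lambda>i. cnj (a i)) O mult_oper \<mu> a"
      using 1 2 3 by (auto simp: mem_mult_oper intro!: relcompI)
    moreover have "f = (\<lambda>i. g i + a i * (cnj (a i) * g i))"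
      using 4 by (rule ext)
    ultimately have "(g, f) \<in> one_plus (mult_oper \<mu> (\<lambda>i. cnj (a i)) O mult_oper \<mu> a)"
      unfolding one_plus_def by (intro CollectI exI[of _ g] exI conjI) auto
    then show "p \<in> ?L"
      unfolding p g_def[symmetric] by simp
  qed
qed

section \<open>Uniqueness of the positive square root\<close>

lemma linear_oper_combination:
  assumes T: "linear_oper \<mu> T" and "(f, g) \<in> T" "(f', g') \<in> T"
  shows "(\<lambda>i. f i + c * f' i, \<lambda>i. g i + c * g' i) \<in> T"
proof -
  have "(\<lambda>i. c * f' i, \<lambda>i. c * g' i) \<in> T"
    using assms unfolding linear_oper_def by blast
  then show ?thesis
    using assms(1,2) unfolding linear_oper_def by fast
qed

text \<open>If \<open>S\<close> is positive and \<open>S\<^sup>2 e = r\<^sup>2 e\<close> with \<open>r > 0\<close>, then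
  \<open>v = S e - r e\<close> satisfies \<open>S v = - r v\<close>, so positivity forces \<open>v = 0\<close>.\<close>

lemma positive_square_root_eigenvector:
  assumes S: "linear_oper \<mu> S" "positive_oper \<mu> S"
    and eg: "(e, g) \<in> S" "(g, \<lambda>i. complex_of_real (r\<^sup>2) * e i) \<in> S" and r: "0 < r"
  shows "g = (\<lambda>i. complex_of_real r * e i)"
proof -
  define v where "v = (\<lambda>i. g i + (- complex_of_real r) * e i)"
  have "(v, \<lambda>i. complex_of_real (r\<^sup>2) * e i + (- complex_of_real r) * g i) \<in> S"
    unfolding v_def by (rule linear_oper_combination[OF S(1) eg(2,1)])
  moreover have "(\<lambda>i. complex_of_real (r\<^sup>2) * e i + (- complex_of_real r) * g i)
      = (\<lambda>i. - complex_of_real r * v i)"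
    by (auto simp: v_def algebra_simps power2_eq_square)
  ultimately have vS: "(v, \<lambda>i. - complex_of_real r * v i) \<in> S"
    by simp
  then have v: "v \<in> wl2 \<mu>"
    using S(1) by (auto simp: linear_oper_def)
  have "complex_of_real (\<mu> i) * (cnj (v i) * (- complex_of_real r * v i))
      = complex_of_real (- r * (\<mu> i * (cmod (v i))\<^sup>2))" for i
    unfolding of_real_mult complex_norm_square by (simp add: mult_ac)
  then have "wl2_inner \<mu> v (\<lambda>i. - complex_of_real r * v i)
      = (\<Sum>\<^sub>\<infinity>i. complex_of_real (- r * (\<mu> i * (cmod (v i))\<^sup>2)))"
    unfolding wl2_inner_def by presburger
  also have "\<dots> = complex_of_real (\<Sum>\<^sub>\<infinity>i. - r * (\<mu> i * (cmod (v i))\<^sup>2))"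
    by (rule infsum_complex_of_real)
  also have "\<dots> = complex_of_real (- r * (wl2_norm \<mu> v)\<^sup>2)"
    unfolding wl2_norm_power2 by (subst infsum_cmult_right') simp
  finally have "complex_of_real (- r * (wl2_norm \<mu> v)\<^sup>2) \<in> \<real>\<^sub>\<ge>\<^sub>0"
    using S(2) vS unfolding positive_oper_def by fastforce
  then have "0 \<le> - r * (wl2_norm \<mu> v)\<^sup>2"
    by (simp only: nonneg_Reals_of_real_iff)
  then have "wl2_norm \<mu> v = 0"
    using r by (simp add: mult_le_0_iff)
  then have "v i = 0" for i
    using coordinate_le_wl2_norm[OF v, of i] pos[of i] by (simp add: mult_le_0_iff)
  then show ?thesis
    by (auto simp: v_def fun_eq_iff)
qed

lemma restrict0_insert:
  assumes "i \<notin> F"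
  shows "restrict0 (insert i F) f = (\<lambda>j. restrict0 F f j + f i * unit_series i j)"
  using assms by (auto simp: restrict0_def unit_series_def fun_eq_iff)

text \<open>Linearity fixes \<open>S\<close> on finitely supported vectors, and boundedness carries
  the formula to limits of truncations.\<close>

lemma bounded_oper_eq_mult_oper:
  assumes S: "bounded_oper \<mu> S"
    and unit: "\<And>i. (unit_series i, \<lambda>j. d i * unit_series i j) \<in> S"
  shows "S = mult_oper \<mu> d"
proof -
  have lin: "linear_oper \<mu> S" and dom: "Domain S = wl2 \<mu>"
    using S by (auto simp: bounded_oper_def)
  obtain C where C: "\<And>f g. (f, g) \<in> S \<Longrightarrow> wl2_norm \<mu> g \<le> C * wl2_norm \<mu> f"
    using S by (fastforce simp: bounded_oper_def)
  have fin: "(restrict0 F f, restrict0 F (\<lambda>i. d i * f i)) \<in> S" if "finite F" for F f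
    using that
  proof induction
    case empty
    then show ?case using lin by (simp add: restrict0_def linear_oper_def)
  next
    case (insert i F)
    show ?case
      using linear_oper_combination[OF lin insert.IH unit[of i], of "f i"] insert.hyps
      by (simp add: restrict0_insert mult_ac)
  qed
  have val: "g = (\<lambda>i. d i * f i)" if fg: "(f, g) \<in> S" for f g
  proof
    fix i
    have f: "f \<in> wl2 \<mu>" using fg lin by (auto simp: linear_oper_def)
    have "sqrt (\<mu> i) * cmod (g i - d i * f i) \<le> 0 + e" if e: "0 < e" for e
    proof -
      \<comment> \<open>The bound \<open>C\<close> may be zero or negative, whereas
        \<open>\<bar>C\<bar> + 1\<close> is positive and at least \<open>C\<close>.\<close>
      have "0 < e / (\<bar>C\<bar> + 1)"
        using e by simp
      moreover have "\<forall>\<^sub>F F in finite_subsets_at_top UNIV. i \<in> F"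
        by (auto simp: eventually_finite_subsets_at_top intro!: exI[of _ "{i}"])
      ultimately obtain F where F: "finite F" "i \<in> F" "wl2_dist \<mu> f (restrict0 F f) < e / (\<bar>C\<bar> + 1)"
        using eventually_happens'[OF finite_subsets_at_top_neq_bot
            eventually_conj[OF eventually_restrict0_close[OF f]]]
        by blast
      have *: "(\<lambda>j. f j - restrict0 F f j, \<lambda>j. g j - restrict0 F (\<lambda>i. d i * f i) j) \<in> S"
        using linear_oper_combination[OF lin fg fin[OF F(1), of f], of "- 1"] by simp
      then have "(\<lambda>j. g j - restrict0 F (\<lambda>i. d i * f i) j) \<in> wl2 \<mu>"
        using lin by (auto simp: linear_oper_def)
      from coordinate_le_wl2_norm[OF this, of i]
      have "sqrt (\<mu> i) * cmod (g i - d i * f i) \<le> wl2_norm \<mu> (\<lambda>j. g j - restrict0 F (\<lambda>i. d i * f i) j)"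
        using F(2) by (simp add: restrict0_def)
      also have "\<dots> \<le> C * wl2_dist \<mu> f (restrict0 F f)"
        unfolding wl2_dist_def by (rule C[OF *])
      also have "\<dots> \<le> (\<bar>C\<bar> + 1) * wl2_dist \<mu> f (restrict0 F f)"
        by (intro mult_right_mono) auto
      also have "\<dots> \<le> e"
        using F(3) by (simp add: field_simps)
      finally show ?thesis by simp
    qed
    then have "sqrt (\<mu> i) * cmod (g i - d i * f i) \<le> 0"
      by (rule field_le_epsilon)
    then show "g i = d i * f i"
      using pos[of i] by (simp add: mult_le_0_iff)
  qed
  show ?thesis
  proof (intro equalityI subsetI)
    fix p assume "p \<in> S"
    then show "p \<in> mult_oper \<mu> d"
      using lin val by (cases p) (auto simp: mem_mult_oper linear_oper_def)
  next
    fix p assume "p \<in> mult_oper \<mu> d"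
    then obtain f where f: "p = (f, \<lambda>i. d i * f i)" "f \<in> wl2 \<mu>"
      by (auto simp: mult_oper_def)
    \<comment> \<open>\<open>S\<close> is defined everywhere, so \<open>f\<close> has some value
      under \<open>S\<close>, and \<open>val\<close> identifies it.\<close>
    then obtain g where "(f, g) \<in> S"
      using dom by blast
    with f val show "p \<in> S" by blast
  qed
qed

text \<open>\<open>inverse_sqrt\<close> is a definite description, so existence and uniqueness are
  both due. Multiplication by \<open>r\<close> is a root. Any other root \<open>S\<close> satisfies
  \<open>S (S e) = r^2 e\<close> on basis vectors, hence \<open>S e = r e\<close> by positivity, and
  a bounded operator is determined by these values.\<close>

lemma inverse_sqrt_eq_mult_oper:
  assumes r: "\<And>i. 0 < r i" "\<And>i. r i \<le> 1"
    and T: "T\<inverse> = mult_oper \<mu> (\<lambda>i. complex_of_real ((r i)\<^sup>2))"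
  shows "inverse_sqrt \<mu> T = mult_oper \<mu> (\<lambda>i. complex_of_real (r i))"
  unfolding inverse_sqrt_def
proof (rule the_equality, intro conjI)
  let ?R = "mult_oper \<mu> (\<lambda>i. complex_of_real (r i))"
  have le: "cmod (complex_of_real (r i) * z) \<le> 1 * cmod z" for i z
    using r[of i] by (simp add: norm_mult mult_left_le_one_le)
  have wl: "(\<lambda>i. complex_of_real (r i) * f i) \<in> wl2 \<mu>" if "f \<in> wl2 \<mu>" for f
    using that le by (rule wl2_dominated(1)) simp
  have "Domain ?R = wl2 \<mu>"
    using wl by (auto simp: mult_oper_def)
  moreover have "wl2_norm \<mu> g \<le> 1 * wl2_norm \<mu> f" if "(f, g) \<in> ?R" for f g
    using that le by (intro wl2_dominated(2)) (auto simp: mem_mult_oper)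
  ultimately show "bounded_oper \<mu> ?R"
    unfolding bounded_oper_def using linear_mult_oper by blast
  have "wl2_inner \<mu> f (\<lambda>i. complex_of_real (r i) * f i) \<in> \<real>\<^sub>\<ge>\<^sub>0" for f
  proof -
    have "complex_of_real (\<mu> i) * (cnj (f i) * (complex_of_real (r i) * f i))
        = complex_of_real (r i * (\<mu> i * (cmod (f i))\<^sup>2))" for i
      unfolding of_real_mult complex_norm_square by (simp add: mult_ac)
    then have "wl2_inner \<mu> f (\<lambda>i. complex_of_real (r i) * f i)
        = complex_of_real (\<Sum>\<^sub>\<infinity>i. r i * (\<mu> i * (cmod (f i))\<^sup>2))"
      unfolding wl2_inner_def by (simp only: infsum_complex_of_real)
    moreover have "0 \<le> (\<Sum>\<^sub>\<infinity>i. r i * (\<mu> i * (cmod (f i))\<^sup>2))"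
      using r(1) by (intro infsum_nonneg mult_nonneg_nonneg weighted_nonneg) (simp add: less_imp_le)
    ultimately show ?thesis
      by (simp only: nonneg_Reals_of_real_iff)
  qed
  then show "positive_oper \<mu> ?R"
    by (auto simp: positive_oper_def mult_oper_def)
  show "?R O ?R = T\<inverse>"
    unfolding T
  proof (intro equalityI subsetI)
    fix p assume "p \<in> ?R O ?R"
    then show "p \<in> mult_oper \<mu> (\<lambda>i. complex_of_real ((r i)\<^sup>2))"
      by (auto simp: mem_mult_oper power2_eq_square mult.assoc)
  next
    fix p assume "p \<in> mult_oper \<mu> (\<lambda>i. complex_of_real ((r i)\<^sup>2))"
    then obtain f where f: "f \<in> wl2 \<mu>" and p: "p = (f, \<lambda>i. complex_of_real ((r i)\<^sup>2) * f i)"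
      by (auto simp: mult_oper_def)
    \<comment> \<open>Because \<open>r \<le> 1\<close>, the intermediate vector lies in the space,
      so the composition is defined everywhere.\<close>
    have "(f, \<lambda>i. complex_of_real (r i) * f i) \<in> ?R"
      "(\<lambda>i. complex_of_real (r i) * f i, \<lambda>i. complex_of_real (r i) * (complex_of_real (r i) * f i)) \<in> ?R"
      using f wl by (auto simp: mem_mult_oper)
    then show "p \<in> ?R O ?R"
      unfolding p power2_eq_square of_real_mult mult.assoc by (rule relcompI)
  qed
next
  fix S assume S: "bounded_oper \<mu> S \<and> positive_oper \<mu> S \<and> S O S = T\<inverse>"
  then have lin: "linear_oper \<mu> S" by (simp add: bounded_oper_def)
  have "(unit_series i, \<lambda>j. complex_of_real (r i) * unit_series i j) \<in> S" for i
  proof -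
    have "(unit_series i, \<lambda>j. complex_of_real ((r i)\<^sup>2) * unit_series i j) \<in> S O S"
      using S T unit_mem_mult_oper[of i "\<lambda>i. complex_of_real ((r i)\<^sup>2)"] by metis
    then obtain g where g: "(unit_series i, g) \<in> S"
        "(g, \<lambda>j. complex_of_real ((r i)\<^sup>2) * unit_series i j) \<in> S"
      by blast
    then have "g = (\<lambda>j. complex_of_real (r i) * unit_series i j)"
      using positive_square_root_eigenvector[OF lin] S r(1) by blast
    with g(1) show ?thesis by simp
  qed
  then show "S = mult_oper \<mu> (\<lambda>i. complex_of_real (r i))"
    using S by (intro bounded_oper_eq_mult_oper) auto
qed

section \<open>Compactness of multiplication operators\<close>

text \<open>By completeness, compactness means that the image \<open>B\<close> of the unit ball is
  totally bounded. Infinitely many \<open>r i \<ge> e\<close> would give infinitely many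
  \<open>e\<close>-separated points of \<open>B\<close>. Conversely, if \<open>r\<close> tends to 0,
  then \<open>B\<close> is uniformly close to its truncation to a finite set of coordinates, which
  has finite nets.\<close>

lemma compact_mult_oper_iff:
  assumes r: "\<And>i. 0 < r i" "\<And>i. r i \<le> 1"
  shows "compact_oper \<mu> (mult_oper \<mu> (\<lambda>i. complex_of_real (r i))) \<longleftrightarrow> (\<forall>e>0. finite {i. e \<le> r i})"
proof -
  let ?R = "mult_oper \<mu> (\<lambda>i. complex_of_real (r i))"
  define B where "B = ?R `` {f \<in> wl2 \<mu>. wl2_norm \<mu> f \<le> 1}"
  have cmod_r: "cmod (complex_of_real (r i) * z) = r i * cmod z" for i z
    using r(1)[of i] by (simp add: norm_mult)
  have wl: "(\<lambda>i. complex_of_real (r i) * f i) \<in> wl2 \<mu>" if "f \<in> wl2 \<mu>" for f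
    using that by (rule wl2_dominated(1)[where C = 1])
      (use r in \<open>simp_all add: cmod_r mult_left_le_one_le less_imp_le\<close>)
  have B: "B = {\<lambda>i. complex_of_real (r i) * f i | f. f \<in> wl2 \<mu> \<and> wl2_norm \<mu> f \<le> 1}"
    unfolding B_def using wl by (auto simp: mult_oper_def)
  have dom: "Domain ?R = wl2 \<mu>"
    using wl by (auto simp: mult_oper_def)
  have sub: "B \<subseteq> wl2 \<mu>"
    using wl by (auto simp: B)
  have "compact_oper \<mu> ?R \<longleftrightarrow> mtotally_bounded B"
    unfolding compact_oper_def mtotally_bounded_eq_compact_closure_of[OF mcomplete_wl2]
    using sub dom linear_mult_oper by (simp add: wl2_topology_eq B_def)
  also have "\<dots> \<longleftrightarrow> (\<forall>e>0. finite {i. e \<le> r i})"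
  proof (intro iffI allI impI)
    fix e :: real assume tb: "mtotally_bounded B" and e: "0 < e"
    \<comment> \<open>The images of the normalised basis vectors; \<open>unit_series i\<close>
      itself has norm \<open>sqrt (\<mu> i)\<close>.\<close>
    define x where "x = (\<lambda>i j. complex_of_real (r i / sqrt (\<mu> i)) * unit_series i j)"
    have xB: "x i \<in> B" for i
    proof -
      let ?u = "\<lambda>j. complex_of_real (1 / sqrt (\<mu> i)) * unit_series i j"
      have "?u \<in> wl2 \<mu>"
        by (rule wl2_scale[OF wl2_unit])
      moreover have "wl2_norm \<mu> ?u \<le> sqrt (card {i}) * 1"
        using pos by (intro wl2_norm_supported_le)
          (auto simp: unit_series_def norm_divide less_imp_le)
      moreover have "x i = (\<lambda>j. complex_of_real (r j) * ?u j)"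
        by (auto simp: x_def unit_series_def)
      ultimately show ?thesis
        unfolding B by (intro CollectI exI[of _ ?u]) simp
    qed
    \<comment> \<open>Coordinate \<open>i\<close> alone suffices, since \<open>x j\<close> vanishes
      there.\<close>
    have sep: "r i \<le> wl2_dist \<mu> (x i) (x j)" if "i \<noteq> j" for i j
    proof -
      have "sqrt (\<mu> i) * cmod (x i i - x j i) = r i"
        using that pos[of i] r(1)[of i]
        by (simp add: x_def unit_series_def norm_divide less_imp_le)
      then show ?thesis
        using coordinate_le_wl2_norm[OF wl2_diff, of "x i" "x j" i] xB sub
        by (auto simp: wl2_dist_def)
    qed
    obtain K where K: "finite K" "B \<subseteq> (\<Union>y\<in>K. mball y (e/2))"
      using tb e unfolding mtotally_bounded_def by (meson half_gt_zero)
    have "\<exists>y\<in>K. x i \<in> mball y (e/2)" for i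
      using K xB by blast
    then obtain c where c: "\<And>i. c i \<in> K" "\<And>i. x i \<in> mball (c i) (e/2)"
      by metis
    \<comment> \<open>Two indices sharing a centre would have images at distance less than
      \<open>e\<close>, against \<open>sep\<close>; so the index set injects into the finite
      net.\<close>
    have "inj_on c {i. e \<le> r i}"
    proof (rule inj_onI, rule ccontr)
      fix i j assume ij: "i \<in> {i. e \<le> r i}" "c i = c j" "i \<noteq> j"
      have "wl2_dist \<mu> (x i) (x j) < e"
        using c(2)[of i] c(2)[of j] ij(2) triangle[of "x i" "c i" "x j"] commute[of "x i" "c i"]
        by auto
      with sep[OF ij(3)] ij(1) show False by simp
    qed
    moreover have "finite (c ` {i. e \<le> r i})"
      using K(1) c(1) by (auto intro: finite_subset)
    ultimately show "finite {i. e \<le> r i}"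
      using finite_imageD by blast
  next
    assume fin: "\<forall>e>0. finite {i. e \<le> r i}"
    show "mtotally_bounded B"
    proof (rule mtotally_bounded_by_external_nets[OF sub])
      fix e :: real assume e: "0 < e"
      \<comment> \<open>One third of \<open>e\<close> bounds the tail off \<open>F\<close>, another
        the net error on \<open>F\<close>; the total stays strictly below \<open>e\<close>.\<close>
      define F where "F = {i. e/3 \<le> r i}"
      have F: "finite F"
        using fin[rule_format, of "e/3"] e unfolding F_def by simp
      \<comment> \<open>The error allowed in each weighted coordinate, so that
        \<open>wl2_norm_supported_le\<close> gives at most \<open>e / 3\<close>; the summand 1 keeps
        the denominator positive for empty \<open>F\<close>.\<close>
      define q where "q = e / 3 / (sqrt (card F) + 1)"
      have q: "0 < q" "sqrt (card F) * q \<le> e / 3"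
      proof -
        have "0 < sqrt (card F) + 1"
          by (smt (verit) real_sqrt_ge_zero of_nat_0_le_iff)
        then show "0 < q" "sqrt (card F) * q \<le> e / 3"
          using e by (simp_all add: q_def field_simps)
      qed
      \<comment> \<open>Coordinate \<open>i\<close> of any element of \<open>B\<close> lies in this
        compact disc; mesh \<open>q / sqrt (\<mu> i)\<close> means weighted error
        \<open>q\<close>.\<close>
      have "\<exists>N. finite N \<and> cball (0::complex) (1 / sqrt (\<mu> i)) \<subseteq> (\<Union>z\<in>N. ball z (q / sqrt (\<mu> i)))"
        for i
      proof -
        have "0 < q / sqrt (\<mu> i)"
          using pos[of i] q(1) by simp
        then show ?thesis
          by (rule compact_cball[THEN compact_eq_totally_bounded[THEN iffD1], THEN conjunct2,
                rule_format])
      qed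
      then obtain N where N: "\<And>i. finite (N i)"
          "\<And>i. cball (0::complex) (1 / sqrt (\<mu> i)) \<subseteq> (\<Union>z\<in>N i. ball z (q / sqrt (\<mu> i)))"
        by metis
      \<comment> \<open>Members of \<open>PiE F N\<close> are \<open>undefined\<close> off
        \<open>F\<close>; \<open>restrict0\<close> resets those values to zero.\<close>
      define K where "K = restrict0 F ` PiE F N"
      have "finite K"
        unfolding K_def by (intro finite_imageI finite_PiE F N)
      moreover have K: "K \<subseteq> wl2 \<mu>"
        unfolding K_def using F by (auto intro!: wl2_finite_support finite_support_restrict0)
      moreover have "B \<subseteq> (\<Union>y\<in>K. mball y e)"
      proof
        fix g assume gB: "g \<in> B"
        then obtain f where f: "f \<in> wl2 \<mu>" "wl2_norm \<mu> f \<le> 1"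
          and g: "g = (\<lambda>i. complex_of_real (r i) * f i)"
          by (auto simp: B)
        have "\<exists>z\<in>N i. cmod (g i - z) \<le> q / sqrt (\<mu> i)" for i
        proof -
          have "cmod (g i) \<le> 1 * cmod (f i)"
            unfolding g cmod_r using r(2) by (intro mult_right_mono) auto
          also have "\<dots> \<le> 1 / sqrt (\<mu> i)"
            using coordinate_le_wl2_norm[OF f(1), of i] f(2) pos[of i]
            by (simp add: pos_le_divide_eq mult.commute)
          finally have "g i \<in> cball 0 (1 / sqrt (\<mu> i))"
            by simp
          then obtain z where "z \<in> N i" "g i \<in> ball z (q / sqrt (\<mu> i))"
            using N(2) by blast
          then show ?thesis
            by (auto simp: dist_norm norm_minus_commute intro!: bexI[of _ z])
        qed
        then obtain h where h: "\<And>i. h i \<in> N i" "\<And>i. cmod (g i - h i) \<le> q / sqrt (\<mu> i)"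
          by metis
        define k where "k = restrict0 F (restrict h F)"
        have kK: "k \<in> K"
          unfolding k_def K_def using h(1) by auto
        have g': "g \<in> wl2 \<mu>" using gB sub by blast
        have "wl2_norm \<mu> (\<lambda>i. k i - restrict0 F g i) \<le> sqrt (card F) * q"
        proof (rule wl2_norm_supported_le[OF F])
          fix i assume "i \<in> F"
          then have "cmod (k i - restrict0 F g i) \<le> q / sqrt (\<mu> i)"
            using h(2)[of i] by (simp add: k_def restrict0_def norm_minus_commute)
          then show "sqrt (\<mu> i) * cmod (k i - restrict0 F g i) \<le> q"
            using pos[of i] by (simp add: field_simps)
        qed (simp add: k_def restrict0_def)
        then have 1: "wl2_dist \<mu> k (restrict0 F g) \<le> e / 3"
          using q(2) by (simp add: wl2_dist_def)
        \<comment> \<open>Off \<open>F\<close> the factor \<open>r i\<close> is below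
          \<open>e / 3\<close>, which makes the tail small uniformly over \<open>B\<close>.\<close>
        have "wl2_norm \<mu> (\<lambda>i. restrict0 F g i - g i) \<le> e / 3 * wl2_norm \<mu> f"
        proof (rule wl2_dominated(2)[OF f(1)])
          fix i
          show "cmod (restrict0 F g i - g i) \<le> e / 3 * cmod (f i)"
          proof (cases "i \<in> F")
            case False
            then show ?thesis
              using mult_right_mono[of "r i" "e / 3" "cmod (f i)"]
              by (simp add: restrict0_def g cmod_r F_def)
          qed (use e in \<open>simp add: restrict0_def\<close>)
        qed (use e in simp)
        also have "\<dots> \<le> e / 3 * 1"
          using f(2) e by (intro mult_left_mono) auto
        finally have 2: "wl2_dist \<mu> (restrict0 F g) g \<le> e / 3"
          by (simp add: wl2_dist_def)
        have "wl2_dist \<mu> k g < e"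
          using triangle[of k "restrict0 F g" g] 1 2 kK K g' restrict0_wl2[OF g', of F] e by auto
        then show "g \<in> (\<Union>y\<in>K. mball y e)"
          using kK K g' by auto
      qed
      ultimately show "\<exists>K. finite K \<and> K \<subseteq> wl2 \<mu> \<and> B \<subseteq> (\<Union>x\<in>K. mball x e)"
        by blast
    qed
  qed
  finally show ?thesis .
qed

text \<open>\<open>d\<close> and its conjugate have the same modulus, so both parametrices are
  multiplication by the same \<open>r\<close>, and small \<open>r\<close> corresponds to large
  \<open>|d|\<close>.\<close>

lemma has_compact_parametrices_mult_oper_iff:
  "has_compact_parametrices \<mu> (mult_oper \<mu> d) \<longleftrightarrow> (\<forall>M>0. finite {i. cmod (d i) \<le> M})"
proof -
  define r where "r = (\<lambda>i. 1 / sqrt (1 + (cmod (d i))\<^sup>2))"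
  have den: "1 \<le> sqrt (1 + (cmod (d i))\<^sup>2)" for i
    by simp
  have r: "0 < r i" "r i \<le> 1" for i
  proof -
    have "0 < sqrt (1 + (cmod (d i))\<^sup>2)"
      using den[of i] by linarith
    then show "0 < r i" "r i \<le> 1"
      using den[of i] unfolding r_def by (simp_all only: zero_less_divide_1_iff divide_le_eq_1_pos)
  qed
  have r2: "(r i)\<^sup>2 = 1 / (1 + (cmod (d i))\<^sup>2)" for i
    by (simp add: r_def power_divide)
  \<comment> \<open>\<open>O\<close> applies its left factor first, so this is the case of
    \<open>D*D\<close>, obtained with \<open>a = cnj d\<close>; the next one, with
    \<open>a = d\<close>, is \<open>DD*\<close>.\<close>
  have "inverse_sqrt \<mu> (one_plus (mult_oper \<mu> d O mult_oper \<mu> (\<lambda>i. cnj (d i))))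
      = mult_oper \<mu> (\<lambda>i. complex_of_real (r i))"
    using inverse_one_plus_square_mult_oper[of "\<lambda>i. cnj (d i)"]
    by (intro inverse_sqrt_eq_mult_oper r) (simp add: r2)
  moreover have "inverse_sqrt \<mu> (one_plus (mult_oper \<mu> (\<lambda>i. cnj (d i)) O mult_oper \<mu> d))
      = mult_oper \<mu> (\<lambda>i. complex_of_real (r i))"
    using inverse_one_plus_square_mult_oper[of d]
    by (intro inverse_sqrt_eq_mult_oper r) (simp add: r2)
  ultimately have "has_compact_parametrices \<mu> (mult_oper \<mu> d) \<longleftrightarrow> (\<forall>e>0. finite {i. e \<le> r i})"
    by (simp add: has_compact_parametrices_def closed_densely_defined_mult_oper
        oper_adjoint_mult_oper compact_mult_oper_iff r)
  also have "\<dots> \<longleftrightarrow> (\<forall>M>0. finite {i. cmod (d i) \<le> M})"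
  proof (intro iffI allI impI)
    fix M :: real assume fin: "\<forall>e>0. finite {i. e \<le> r i}" and M: "0 < M"
    have "0 < 1 + M\<^sup>2"
      by (smt (verit) zero_le_power2)
    moreover have "1 / sqrt (1 + M\<^sup>2) \<le> r i" if "cmod (d i) \<le> M" for i
      unfolding r_def using that by (intro divide_left_mono) (auto simp: add_pos_nonneg power_mono)
    ultimately show "finite {i. cmod (d i) \<le> M}"
      by (intro finite_subset[OF _ fin[rule_format, of "1 / sqrt (1 + M\<^sup>2)"]]) auto
  next
    fix e :: real assume fin: "\<forall>M>0. finite {i. cmod (d i) \<le> M}" and e: "0 < e"
    \<comment> \<open>\<open>|d|\<close> is at most \<open>sqrt (1 + |d|^2) = 1 / r\<close>.\<close>
    have "cmod (d i) \<le> 1 / e" if "e \<le> r i" for i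
    proof -
      have "cmod (d i) \<le> sqrt (1 + (cmod (d i))\<^sup>2)"
        by (rule real_le_rsqrt) simp
      also have "\<dots> \<le> 1 / e"
      proof -
        have "0 < sqrt (1 + (cmod (d i))\<^sup>2)"
          using den[of i] by linarith
        then show ?thesis
          using that e unfolding r_def by (simp only: pos_le_divide_eq mult.commute)
      qed
      finally show ?thesis .
    qed
    then show "finite {i. e \<le> r i}"
      using fin e by (auto intro!: finite_subset[of "{i. e \<le> r i}" "{i. cmod (d i) \<le> 1 / e}"])
  qed
  finally show ?thesis .
qed

end

section \<open>The operator on formal series\<close>

text \<open>Both projections of the support are finite, so every eventual constant is 0. This puts
  the core of the multiplication operator inside the algebra.\<close>

lemma finite_support_in_series_algebra:
  assumes fin: "finite {i. a i \<noteq> 0}"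
  shows "a \<in> series_algebra"
proof -
  have "finite {n. \<exists>k. a (n, k) \<noteq> 0}"
    by (rule finite_subset[OF _ finite_imageI[OF fin, of fst]]) force
  moreover have "eventually_constant (\<lambda>k. a (n, k))" for n
  proof -
    have "finite {k. a (n, k) \<noteq> 0}"
      by (rule finite_subset[OF _ finite_imageI[OF fin, of snd]]) force
    then obtain B where "abs ` {k. a (n, k) \<noteq> 0} \<subseteq> {..B}"
      by (auto simp: finite_int_iff_bounded_le)
    then have "a (n, k) = 0" if "B < \<bar>k\<bar>" for k
      using that by force
    then show ?thesis
      unfolding eventually_constant_def
      by (intro exI[of _ "\<bar>B\<bar> + 1"] conjI exI[of _ "0::complex"]) auto
  qed
  ultimately show ?thesis
    by (simp add: series_algebra_def)
qed

text \<open>The difference of left and right multiplication acts on each coordinate by the symbol,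
  so the core argument of \<open>oper_closure_eq_mult_oper\<close> applies.\<close>

lemma D_oper_eq_mult_oper:
  assumes "\<And>k. 0 < w k"
  shows "D_oper w \<beta> \<alpha> = mult_oper (series_weight w) (\<lambda>(n, k). \<beta> (k + n) - \<alpha> k)"
proof -
  interpret l2_weight "series_weight w"
    by unfold_locales (simp add: series_weight_def assms split: prod.split)
  have "(\<lambda>i. diag_mult_left \<beta> a i - diag_mult_right a \<alpha> i)
      = (\<lambda>i. (case i of (n, k) \<Rightarrow> \<beta> (k + n) - \<alpha> k) * a i)" for a
    by (auto simp: diag_mult_left_def diag_mult_right_def algebra_simps)
  then show ?thesis
    unfolding D_oper_def
    by (intro oper_closure_eq_mult_oper) (auto intro: finite_support_in_series_algebra)
qed

theorem proposition6p3:
  fixes w :: "int \<Rightarrow> real" and \<alpha> \<beta> :: "int \<Rightarrow> complex"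
  assumes "\<And>k. 0 < w k"
    and "(w has_sum 1) UNIV"
    and "\<exists>L. ((\<lambda>k. \<beta> k - \<beta> (k - 1)) \<longlongrightarrow> L) at_top"
    and "\<exists>L. ((\<lambda>k. \<beta> k - \<beta> (k - 1)) \<longlongrightarrow> L) at_bot"
    and "(\<lambda>k. (cmod (\<beta> k - \<alpha> k))\<^sup>2 * w k) summable_on UNIV"
  shows "has_compact_parametrices (series_weight w) (D_oper w \<beta> \<alpha>) \<longleftrightarrow>
    (\<forall>M>0. finite {(n, k). \<not> cmod (\<beta> (k + n) - \<alpha> k) > M})"
proof -
  interpret l2_weight "series_weight w"
    by unfold_locales (simp add: series_weight_def assms(1) split: prod.split)
  have "{i. cmod (case i of (n, k) \<Rightarrow> \<beta> (k + n) - \<alpha> k) \<le> M}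
      = {(n, k). \<not> cmod (\<beta> (k + n) - \<alpha> k) > M}" for M
    by auto
  then show ?thesis
    by (simp add: D_oper_eq_mult_oper assms(1) has_compact_parametrices_mult_oper_iff)
qed

end
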